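(* Let $R$ be a commutative ring with identity $1\neq 0$ and let $I$ be an ideal of $R$ such that $I\subseteq Z(R)$ and $Z(R)$ is an ideal of $R$. If $\mathrm{diam}(\overline{\Gamma}(R))=2$ and $\overline{\Gamma}(R)$ has Condition A, then $\mathrm{diam}(\overline{\Gamma}(R\Join I))=2$.
   Context: For a commutative ring $A$ with $1\neq 0$, $Z(A)$ is the set of zero-divisors of $A$ (including $0$) and $Z(A)^*=Z(A)\setminus\{0\}$. The extended zero-divisor graph $\overline{\Gamma}(A)$ is the simple graph with vertex set $Z(A)^*$ in which distinct vertices $x,y$ are adjacent if and only if there exist integers $n,m\geq 1$ with $x^ny^m=0$, $x^n\neq 0$ and $y^m\neq 0$. The distance $d(u,v)$ between two vertices is the length of a shortest path joining them ($\infty$ if there is none), and the diameter $\mathrm{diam}(G)$ of a graph $G$ is the supremum of $d(u,v)$ over all vertices $u,v$. A graph $G$ has Condition A if every edge of $G$ is part of a triangle, i.e. for every pair of adjacent vertices $u,v$ there is a vertex of $G$ adjacent to both $u$ and $v$. For an ideal $I$ of $R$, the amalgamated duplication of $R$ along $I$ is the subring $R\Join I=\{(r,r+i) : r\in R,\ i\in I\}$ of $R\times R$. *)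

theory Defs
  imports
    "HOL-Algebra.Chinese_Remainder"
    "HOL-Algebra.Subrings"
    "HOL-Library.Extended_Nat"
    "Graph_Theory.Pair_Digraph"
    "Graph_Theory.Arc_Walk"
begin

section \<open>Graphs: distance, diameter, Condition A\<close>

text \<open>A simple graph is represented as a symmetric loop-free \<^typ>\<open>'a pair_pre_digraph\<close>:
  an edge between \<open>u\<close> and \<open>v\<close> is the pair of arcs \<open>(u, v)\<close> and \<open>(v, u)\<close>. Finiteness is not
  assumed, so the locale \<^locale>\<open>pair_graph\<close> is not used.\<close>

text \<open>The infimum of the empty set is \<open>\<infinity>\<close> in \<^typ>\<open>enat\<close>, so vertices not joined by a path are
  at distance \<open>\<infinity>\<close>.\<close>

definition graph_dist :: "'a pair_pre_digraph \<Rightarrow> 'a \<Rightarrow> 'a \<Rightarrow> enat" where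
  "graph_dist G u v = (INF p \<in> {p. pre_digraph.apath (with_proj G) u p v}. enat (length p))"

definition graph_diam :: "'a pair_pre_digraph \<Rightarrow> enat" where
  "graph_diam G = (SUP u \<in> pverts G. SUP v \<in> pverts G. graph_dist G u v)"

definition condition_A :: "'a pair_pre_digraph \<Rightarrow> bool" where
  "condition_A G \<longleftrightarrow>
     (\<forall>(u, v) \<in> parcs G. \<exists>w \<in> pverts G. (u, w) \<in> parcs G \<and> (v, w) \<in> parcs G)"


section \<open>The extended zero-divisor graph\<close>

definition zero_divisors :: "('a, 'm) ring_scheme \<Rightarrow> 'a set" where
  "zero_divisors A =
     {x \<in> carrier A. \<exists>y \<in> carrier A. y \<noteq> \<zero>\<^bsub>A\<^esub> \<and> x \<otimes>\<^bsub>A\<^esub> y = \<zero>\<^bsub>A\<^esub>}"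

definition ext_zero_divisor_graph :: "('a, 'm) ring_scheme \<Rightarrow> 'a pair_pre_digraph" where
  "ext_zero_divisor_graph A =
     \<lparr> pverts = zero_divisors A - {\<zero>\<^bsub>A\<^esub>},
       parcs = {(x, y). x \<in> zero_divisors A - {\<zero>\<^bsub>A\<^esub>} \<and> y \<in> zero_divisors A - {\<zero>\<^bsub>A\<^esub>} \<and> x \<noteq> y \<and>
         (\<exists>(n::nat) (m::nat). n \<ge> 1 \<and> m \<ge> 1 \<and>
            x [^]\<^bsub>A\<^esub> n \<otimes>\<^bsub>A\<^esub> y [^]\<^bsub>A\<^esub> m = \<zero>\<^bsub>A\<^esub> \<and>
            x [^]\<^bsub>A\<^esub> n \<noteq> \<zero>\<^bsub>A\<^esub> \<and> y [^]\<^bsub>A\<^esub> m \<noteq> \<zero>\<^bsub>A\<^esub>)} \<rparr>"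

lemma (in cring) zero_in_zero_divisors:
  assumes "\<one> \<noteq> \<zero>" shows "\<zero> \<in> zero_divisors R"
  using assms by (auto simp: zero_divisors_def intro!: bexI[of _ \<one>])

lemma (in cring) ext_zero_divisor_graph_simple:
  shows "pair_loopfree_digraph (ext_zero_divisor_graph R)"
    and "sym (parcs (ext_zero_divisor_graph R))"
proof -
  show "pair_loopfree_digraph (ext_zero_divisor_graph R)"
    by unfold_locales (auto simp: ext_zero_divisor_graph_def)
  show "sym (parcs (ext_zero_divisor_graph R))"
  proof (rule symI)
    fix x y assume a: "(x, y) \<in> parcs (ext_zero_divisor_graph R)"
    then have "x \<in> carrier R" "y \<in> carrier R"
      by (auto simp: ext_zero_divisor_graph_def zero_divisors_def)
    then have "x [^] n \<otimes> y [^] m = y [^] m \<otimes> x [^] n" for n m :: nat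
      by (simp add: m_comm)
    with a show "(y, x) \<in> parcs (ext_zero_divisor_graph R)"
      by (fastforce simp: ext_zero_divisor_graph_def)
  qed
qed


section \<open>Amalgamated duplication of a ring along an ideal\<close>

definition amalgamated_duplication :: "('a, 'm) ring_scheme \<Rightarrow> 'a set \<Rightarrow> ('a \<times> 'a) ring"
    (infixl \<open>\<Join>\<close> 70) where
  "R \<Join> I = (RDirProd R R)\<lparr>carrier := {(r, r \<oplus>\<^bsub>R\<^esub> i) | r i. r \<in> carrier R \<and> i \<in> I}\<rparr>"

lemma (in cring) amalgamated_duplication_subring:
  assumes "ideal I R" shows "subring (carrier (R \<Join> I)) (RDirProd R R)"
proof -
  interpret I: ideal I R by fact
  interpret P: ring "RDirProd R R"
    by (rule RDirProd_ring) (rule ring_axioms)+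
  note prod_defs = RDirProd_def DirProd_def monoid.defs
  have I_carrier: "i \<in> carrier R" if "i \<in> I" for i
    using that by (rule I.Icarr)
  have car: "carrier (R \<Join> I) = {(r, r \<oplus> i) | r i. r \<in> carrier R \<and> i \<in> I}"
    by (simp add: amalgamated_duplication_def)
  have sub: "carrier (R \<Join> I) \<subseteq> carrier (RDirProd R R)"
    using I_carrier by (auto simp: car RDirProd_carrier)
  show ?thesis
  proof (rule P.subringI[OF sub])
    have "(\<one>, \<one> \<oplus> \<zero>) \<in> carrier (R \<Join> I)"
      unfolding car using I.zero_closed by blast
    then show "\<one>\<^bsub>RDirProd R R\<^esub> \<in> carrier (R \<Join> I)"
      by (simp add: prod_defs)
  next
    fix h assume "h \<in> carrier (R \<Join> I)"
    then obtain r i where h: "h = (r, r \<oplus> i)" "r \<in> carrier R" "i \<in> I"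
      by (auto simp: car)
    have "\<ominus>\<^bsub>RDirProd R R\<^esub> h = (\<ominus> r, \<ominus> r \<oplus> \<ominus> i)"
      using h I_carrier[OF h(3)]
      by (intro P.minus_equality) (auto simp: prod_defs l_neg minus_add[symmetric])
    moreover have "\<ominus> i \<in> I" using h(3) by (rule I.a_inv_closed)
    ultimately show "\<ominus>\<^bsub>RDirProd R R\<^esub> h \<in> carrier (R \<Join> I)"
      using h(2) by (auto simp: car)
  next
    fix h k assume "h \<in> carrier (R \<Join> I)" "k \<in> carrier (R \<Join> I)"
    then obtain r i s j where h: "h = (r, r \<oplus> i)" "r \<in> carrier R" "i \<in> I"
      and k: "k = (s, s \<oplus> j)" "s \<in> carrier R" "j \<in> I"
      by (auto simp: car)
    note c = h(2) k(2) I_carrier[OF h(3)] I_carrier[OF k(3)]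
    let ?l = "r \<otimes> j \<oplus> (i \<otimes> s \<oplus> i \<otimes> j)"
    have "?l \<in> I"
      using h k c by (intro I.a_closed I.I_l_closed I.I_r_closed) auto
    moreover have "h \<otimes>\<^bsub>RDirProd R R\<^esub> k = (r \<otimes> s, r \<otimes> s \<oplus> ?l)"
      using c by (simp add: h k prod_defs l_distr r_distr a_ac)
    ultimately show "h \<otimes>\<^bsub>RDirProd R R\<^esub> k \<in> carrier (R \<Join> I)"
      using c by (auto simp: car)
    have "i \<oplus> j \<in> I" using h k by (intro I.a_closed)
    moreover have "h \<oplus>\<^bsub>RDirProd R R\<^esub> k = (r \<oplus> s, (r \<oplus> s) \<oplus> (i \<oplus> j))"
      using c by (simp add: h k prod_defs a_ac)
    ultimately show "h \<oplus>\<^bsub>RDirProd R R\<^esub> k \<in> carrier (R \<Join> I)"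
      using c by (auto simp: car)
  qed
qed

lemma (in cring) amalgamated_duplication_cring:
  assumes "ideal I R" shows "cring (R \<Join> I)"
proof -
  interpret I: ideal I R by fact
  interpret P: ring "RDirProd R R"
    by (rule RDirProd_ring) (rule ring_axioms)+
  have "ring (R \<Join> I)"
    using P.subring_is_ring[OF amalgamated_duplication_subring[OF assms]]
    by (simp add: amalgamated_duplication_def)
  then interpret D: ring "R \<Join> I" .
  show ?thesis
    by unfold_locales
       (use I.Icarr in \<open>auto simp: amalgamated_duplication_def RDirProd_def DirProd_def
          monoid.defs m_comm\<close>)
qed

end

theory Submission
  imports Defs
begin

text \<open>Diameter two together with Condition A says that any two vertices \<open>x\<close>, \<open>y\<close> of the graph of
  \<open>R\<close>, equal or not, have nonzero powers killed by a single nonzero \<open>w\<close>. For vertices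
  \<open>a\<close>, \<open>b\<close> of the graph of \<open>R \<Join> I\<close>, pick a coordinate in which both are nonzero (if there is none,
  then \<open>ab = 0\<close>) and the corresponding \<open>w\<close>. If \<open>wI = 0\<close>, then multiplication by \<open>w\<close> does not
  distinguish the two coordinates, and \<open>c = (w, w)\<close> kills powers of \<open>a\<close> and \<open>b\<close>; if
  \<open>wi \<noteq> 0\<close> for some \<open>i \<in> I\<close>, then \<open>wi\<close> placed in the chosen coordinate does. This \<open>c\<close> joins \<open>a\<close> to \<open>b\<close>
  unless it is one of them, in which case \<open>a\<close> and \<open>b\<close> are adjacent. The lower bound comes from
  the diagonal copy of \<open>R\<close>.\<close>

section \<open>Distances at most one and two in terms of arcs\<close>

lemma graph_dist_le_enat_iff:
  "graph_dist G u v \<le> enat n \<longleftrightarrow> (\<exists>p. pre_digraph.apath (with_proj G) u p v \<and> length p \<le> n)"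
proof -
  \<comment> \<open>A strict bound on an infimum is witnessed by a member of the set; this yields
    the path.\<close>
  have "graph_dist G u v \<le> enat n \<longleftrightarrow> graph_dist G u v < enat (Suc n)"
    by (cases "graph_dist G u v") auto
  also have "\<dots> \<longleftrightarrow> (\<exists>p. pre_digraph.apath (with_proj G) u p v \<and> length p < Suc n)"
    by (auto simp: graph_dist_def INF_less_iff)
  finally show ?thesis by (simp add: less_Suc_eq_le)
qed

context pair_loopfree_digraph
begin

lemma graph_dist_le_1_iff:
  assumes "u \<in> pverts G"
  shows "graph_dist G u v \<le> 1 \<longleftrightarrow> u = v \<or> (u, v) \<in> parcs G"
proof
  assume "graph_dist G u v \<le> 1"
  then obtain p where p: "apath u p v" "length p \<le> 1"
    by (auto simp: one_enat_def graph_dist_le_enat_iff)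
  then show "u = v \<or> (u, v) \<in> parcs G"
    by (cases p) (auto simp: apath_def awalk_def)
next
  assume "u = v \<or> (u, v) \<in> parcs G"
  then have "apath u (if u = v then [] else [(u, v)]) v"
    using assms by (auto simp: apath_def awalk_def)
  then show "graph_dist G u v \<le> 1"
    unfolding one_enat_def graph_dist_le_enat_iff by (intro exI conjI) auto
qed

lemma graph_dist_le_2_iff:
  assumes "u \<in> pverts G"
  shows "graph_dist G u v \<le> 2 \<longleftrightarrow>
    u = v \<or> (u, v) \<in> parcs G \<or> (\<exists>w. (u, w) \<in> parcs G \<and> (w, v) \<in> parcs G)"
    (is "_ \<longleftrightarrow> ?adj")
proof
  assume "graph_dist G u v \<le> 2"
  then obtain p where p: "apath u p v" "length p \<le> 2"
    by (auto simp: numeral_eq_enat graph_dist_le_enat_iff)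
  \<comment> \<open>\<open>remdups_adj.cases\<close> serves only to split lists into lengths zero,
    one and at least two.\<close>
  then consider "p = []" | e where "p = [e]" | e f where "p = [e, f]"
    by (cases p rule: remdups_adj.cases) auto
  then show ?adj
    using p(1) by cases (auto simp: apath_def awalk_def)
next
  assume adj: ?adj
  show "graph_dist G u v \<le> 2"
  proof (cases "u = v \<or> (u, v) \<in> parcs G")
    case True
    then have "graph_dist G u v \<le> 1"
      using graph_dist_le_1_iff[OF assms] by simp
    also have "(1::enat) \<le> 2" by simp
    finally show ?thesis .
  next
    case False
    with adj obtain w where w: "(u, w) \<in> parcs G" "(w, v) \<in> parcs G" by blast
    \<comment> \<open>Absence of loops separates \<open>w\<close> from both ends, so the walk of two
      arcs repeats no vertex and is a path.\<close>
    then have "u \<noteq> w" "w \<noteq> v" using no_loops by force+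
    with False w assms have "apath u [(u, w), (w, v)] v"
      by (auto simp: apath_def awalk_def)
    then show ?thesis
      unfolding numeral_eq_enat graph_dist_le_enat_iff by (intro exI conjI) auto
  qed
qed

end

section \<open>Annihilators of powers of vertices in a commutative ring\<close>

context cring
begin

abbreviation EZG :: "'a pair_pre_digraph" where
  "EZG \<equiv> ext_zero_divisor_graph R"

lemma parcs_EZG_iff:
  "(x, y) \<in> parcs EZG \<longleftrightarrow> x \<in> pverts EZG \<and> y \<in> pverts EZG \<and> x \<noteq> y \<and>
     (\<exists>(n::nat) (m::nat). n \<ge> 1 \<and> m \<ge> 1 \<and> x [^] n \<otimes> y [^] m = \<zero> \<and> x [^] n \<noteq> \<zero> \<and> y [^] m \<noteq> \<zero>)"
  by (simp add: ext_zero_divisor_graph_def)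

lemma pverts_EZG_iff: "x \<in> pverts EZG \<longleftrightarrow> x \<in> zero_divisors R \<and> x \<noteq> \<zero>"
  by (simp add: ext_zero_divisor_graph_def)

lemma zero_divisors_carrier: "x \<in> zero_divisors R \<Longrightarrow> x \<in> carrier R"
  by (simp add: zero_divisors_def)

lemma parcs_EZG_sym: "(x, y) \<in> parcs EZG \<Longrightarrow> (y, x) \<in> parcs EZG"
  using ext_zero_divisor_graph_simple(2) by (meson symD)

text \<open>Exponent 1 serves for \<open>c\<close>, which is nonzero, and \<open>c\<close> is a
  zero-divisor because the nonzero \<open>x [^] n\<close> kills it.\<close>

lemma parcs_EZG_if_kills_power:
  fixes n :: nat
  assumes x: "x \<in> pverts EZG" and c: "c \<in> carrier R" "c \<noteq> \<zero>" "x \<noteq> c"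
    and n: "n \<ge> 1" "x [^] n \<noteq> \<zero>" "x [^] n \<otimes> c = \<zero>"
  shows "(x, c) \<in> parcs EZG"
proof -
  have xc: "x \<in> carrier R" using x by (simp add: pverts_EZG_iff zero_divisors_carrier)
  then have "c \<otimes> x [^] n = \<zero>" using n c by (simp add: m_comm)
  then have "c \<in> pverts EZG"
    using xc c n by (auto simp: pverts_EZG_iff zero_divisors_def)
  moreover have "x [^] n \<otimes> c [^] (1::nat) = \<zero>" "c [^] (1::nat) \<noteq> \<zero>"
    using n c by simp_all
  ultimately show ?thesis
    using x c n unfolding parcs_EZG_iff by blast
qed

text \<open>The element \<open>c\<close> is a common neighbour unless it equals \<open>x\<close> or
  \<open>y\<close>; then the remaining arc joins \<open>x\<close> to \<open>y\<close> directly, or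
  \<open>x = y\<close>.\<close>

lemma graph_dist_le_2_if_common_annihilator:
  fixes n m :: nat
  assumes x: "x \<in> pverts EZG" "n \<ge> 1" "x [^] n \<noteq> \<zero>" "x [^] n \<otimes> c = \<zero>"
    and y: "y \<in> pverts EZG" "m \<ge> 1" "y [^] m \<noteq> \<zero>" "y [^] m \<otimes> c = \<zero>"
    and c: "c \<in> carrier R" "c \<noteq> \<zero>"
  shows "graph_dist EZG x y \<le> 2"
proof -
  interpret G: pair_loopfree_digraph EZG by (rule ext_zero_divisor_graph_simple)
  have "(x, c) \<in> parcs EZG" if "x \<noteq> c"
    using parcs_EZG_if_kills_power x c that by blast
  moreover have "(c, y) \<in> parcs EZG" if "y \<noteq> c"
    using parcs_EZG_if_kills_power parcs_EZG_sym y c that by blast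
  ultimately show ?thesis
    unfolding G.graph_dist_le_2_iff[OF x(1)] by blast
qed

text \<open>A common neighbour \<open>z\<close> comes from Condition A if \<open>x\<close> and
  \<open>y\<close> are adjacent, and from the diameter otherwise. A power of \<open>z\<close> then
  serves as \<open>w\<close>.\<close>

lemma common_annihilator_of_powers_neq:
  assumes x: "x \<in> pverts EZG" and y: "y \<in> pverts EZG" and neq: "x \<noteq> y"
    and diam: "graph_diam EZG \<le> 2" and A: "condition_A EZG"
  obtains w and n m :: nat where "w \<in> carrier R" "w \<noteq> \<zero>" "n \<ge> 1" "m \<ge> 1"
    "x [^] n \<noteq> \<zero>" "y [^] m \<noteq> \<zero>" "w \<otimes> x [^] n = \<zero>" "w \<otimes> y [^] m = \<zero>"
proof -
  interpret G: pair_loopfree_digraph EZG by (rule ext_zero_divisor_graph_simple)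
  have "graph_dist EZG x y \<le> graph_diam EZG"
    unfolding graph_diam_def using x y by (meson SUP_upper2 SUP_upper order_refl)
  with diam have "graph_dist EZG x y \<le> 2" by simp
  then consider "(x, y) \<in> parcs EZG" | z where "(x, z) \<in> parcs EZG" "(z, y) \<in> parcs EZG"
    using neq unfolding G.graph_dist_le_2_iff[OF x] by blast
  then obtain z where z: "(x, z) \<in> parcs EZG" "(y, z) \<in> parcs EZG"
  proof cases
    case 1
    with A show thesis unfolding condition_A_def by (auto intro: that)
  next
    case 2
    then show thesis by (blast intro: that parcs_EZG_sym)
  qed
  then obtain n k m l :: nat where
    n: "n \<ge> 1" "x [^] n \<noteq> \<zero>" "x [^] n \<otimes> z [^] k = \<zero>" "z [^] k \<noteq> \<zero>" and
    m: "m \<ge> 1" "y [^] m \<noteq> \<zero>" "y [^] m \<otimes> z [^] l = \<zero>" "z [^] l \<noteq> \<zero>"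
    unfolding parcs_EZG_iff by blast
  have car: "x \<in> carrier R" "y \<in> carrier R" "z \<in> carrier R"
    using x y z by (auto simp: parcs_EZG_iff pverts_EZG_iff zero_divisors_carrier)
  \<comment> \<open>The two arcs may use different powers of \<open>z\<close>. The one with the
    larger exponent is a multiple of both, and it is nonzero because it is one of the two.\<close>
  have kills: "z [^] max k l \<otimes> u = \<zero>"
    if "j \<in> {k, l}" "u \<otimes> z [^] j = \<zero>" "u \<in> carrier R" for u and j
  proof -
    have "z [^] max k l = z [^] (max k l - j) \<otimes> z [^] j"
      using that(1) car by (auto simp: nat_pow_mult)
    then have "z [^] max k l \<otimes> u = z [^] (max k l - j) \<otimes> (u \<otimes> z [^] j)"
      using car that(3) by (simp add: m_ac)
    then show ?thesis using that(2) car by simp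
  qed
  show thesis
    by (rule that[of "z [^] max k l" n m])
       (use n m kills[of k] kills[of l] car in \<open>auto simp: max_def\<close>)
qed

lemma common_annihilator_of_powers:
  assumes x: "x \<in> pverts EZG" and y: "y \<in> pverts EZG"
    and diam: "graph_diam EZG = 2" and A: "condition_A EZG"
  obtains w and n m :: nat where "w \<in> carrier R" "w \<noteq> \<zero>" "n \<ge> 1" "m \<ge> 1"
    "x [^] n \<noteq> \<zero>" "y [^] m \<noteq> \<zero>" "w \<otimes> x [^] n = \<zero>" "w \<otimes> y [^] m = \<zero>"
proof (cases "x = y")
  case False
  then show thesis
    using common_annihilator_of_powers_neq[OF x y False _ A] diam that by auto
next
  case True
  interpret G: pair_loopfree_digraph EZG by (rule ext_zero_divisor_graph_simple)
  \<comment> \<open>A second vertex reduces the case \<open>x = y\<close> to distinct vertices; a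
    one-vertex graph would have diameter at most 1.\<close>
  have "\<exists>v \<in> pverts EZG. v \<noteq> x"
  proof (rule ccontr)
    assume "\<not> ?thesis"
    then have "pverts EZG = {x}" using x by blast
    then have "graph_diam EZG = graph_dist EZG x x" by (simp add: graph_diam_def)
    also have "\<dots> \<le> 1" using G.graph_dist_le_1_iff[OF x] by simp
    finally show False using diam by simp
  qed
  then obtain v where v: "v \<in> pverts EZG" "x \<noteq> v" by blast
  show thesis
    using common_annihilator_of_powers_neq[OF x v _ A] diam that True by auto
qed

end

section \<open>The duplication in coordinates, its annihilators and zero-divisors\<close>

lemma amalgamated_duplication_simps:
  fixes R (structure) and x y :: "'a \<times> 'a"
  shows "\<zero>\<^bsub>R \<Join> I\<^esub> = (\<zero>, \<zero>)"
    and "x \<otimes>\<^bsub>R \<Join> I\<^esub> y = (fst x \<otimes> fst y, snd x \<otimes> snd y)"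
    and "x [^]\<^bsub>R \<Join> I\<^esub> (n::nat) = (fst x [^] n, snd x [^] n)"
proof -
  show "\<zero>\<^bsub>R \<Join> I\<^esub> = (\<zero>, \<zero>)"
    and mult: "x \<otimes>\<^bsub>R \<Join> I\<^esub> y = (fst x \<otimes> fst y, snd x \<otimes> snd y)" for x y
    by (auto simp: amalgamated_duplication_def RDirProd_def DirProd_def monoid.defs split: prod.split)
  have "\<one>\<^bsub>R \<Join> I\<^esub> = (\<one>, \<one>)"
    by (simp add: amalgamated_duplication_def RDirProd_def DirProd_def monoid.defs)
  then show "x [^]\<^bsub>R \<Join> I\<^esub> (n::nat) = (fst x [^] n, snd x [^] n)"
    by (induction n) (simp_all add: mult)
qed

lemma (in abelian_group) add_diff_cancel_carrier:
  assumes "x \<in> carrier G" "y \<in> carrier G"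
  shows "x \<oplus> (y \<ominus> x) = y"
proof -
  have "x \<oplus> (y \<ominus> x) = y \<oplus> (x \<oplus> \<ominus> x)"
    using assms by (simp add: minus_eq a_lcomm)
  then show ?thesis using assms by (simp add: r_neg)
qed

context ideal
begin

text \<open>Testing the difference of the coordinates replaces the existential parameters
  \<open>r\<close> and \<open>i\<close>, so membership can be checked by rewriting.\<close>

lemma amalgamated_duplication_carrier_iff:
  "x \<in> carrier (R \<Join> I) \<longleftrightarrow> fst x \<in> carrier R \<and> snd x \<in> carrier R \<and> snd x \<ominus> fst x \<in> I"
proof
  assume "x \<in> carrier (R \<Join> I)"
  then obtain r i where "x = (r, r \<oplus> i)" "r \<in> carrier R" "i \<in> I"
    by (auto simp: amalgamated_duplication_def)
  moreover then have "r \<oplus> i \<ominus> r = i"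
    using Icarr by (simp add: minus_eq a_comm[of r i] a_assoc r_neg)
  ultimately show "fst x \<in> carrier R \<and> snd x \<in> carrier R \<and> snd x \<ominus> fst x \<in> I"
    using Icarr by auto
next
  assume x: "fst x \<in> carrier R \<and> snd x \<in> carrier R \<and> snd x \<ominus> fst x \<in> I"
  then have "(fst x, fst x \<oplus> (snd x \<ominus> fst x)) \<in> carrier (R \<Join> I)"
    unfolding amalgamated_duplication_def by auto
  with x show "x \<in> carrier (R \<Join> I)"
    by (simp add: add_diff_cancel_carrier)
qed

text \<open>The projection \<open>f\<close> stands for the chosen coordinate. One \<open>c\<close>
  works for all \<open>p\<close>, so it applies to powers of two vertices at once.\<close>

lemma amalgamated_duplication_annihilator:
  assumes "cring R" and f: "f = fst \<or> f = snd" and w: "w \<in> carrier R" "w \<noteq> \<zero>"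
  obtains c where "c \<in> carrier (R \<Join> I)" "c \<noteq> \<zero>\<^bsub>R \<Join> I\<^esub>"
    "\<And>p. p \<in> carrier (R \<Join> I) \<Longrightarrow> w \<otimes> f p = \<zero> \<Longrightarrow> p \<otimes>\<^bsub>R \<Join> I\<^esub> c = \<zero>\<^bsub>R \<Join> I\<^esub>"
proof (cases "\<forall>i \<in> I. w \<otimes> i = \<zero>")
  interpret cring R by fact
  note simps = amalgamated_duplication_simps amalgamated_duplication_carrier_iff
  case True
  have "p \<otimes>\<^bsub>R \<Join> I\<^esub> (w, w) = \<zero>\<^bsub>R \<Join> I\<^esub>" if p: "p \<in> carrier (R \<Join> I)" "w \<otimes> f p = \<zero>" for p
  proof -
    \<comment> \<open>The difference of the coordinates of \<open>p\<close> lies in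
      \<open>I\<close>, so \<open>w\<close> kills it; hence \<open>w\<close> kills both coordinates
      once it kills one.\<close>
    have car: "fst p \<in> carrier R" "snd p \<in> carrier R" and "w \<otimes> (snd p \<ominus> fst p) = \<zero>"
      using p(1) True by (auto simp: simps)
    then have "w \<otimes> snd p \<ominus> w \<otimes> fst p = \<zero>"
      using w by (simp add: minus_eq r_distr r_minus)
    then have "w \<otimes> snd p = w \<otimes> fst p"
      using w car by simp
    then show ?thesis
      using p(2) f w car by (auto simp: simps m_comm)
  qed
  then show thesis
    using w by (intro that[of "(w, w)"]) (simp_all add: simps minus_eq r_neg)
next
  interpret cring R by fact
  note simps = amalgamated_duplication_simps amalgamated_duplication_carrier_iff
  case False
  then obtain i where i: "i \<in> I" "w \<otimes> i \<noteq> \<zero>" by blast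
  have wi: "w \<otimes> i \<in> I" "i \<in> carrier R" "w \<otimes> i \<in> carrier R"
    using i w Icarr by (auto intro: I_l_closed)
  have kills: "x \<otimes> (w \<otimes> i) = \<zero>" if "w \<otimes> x = \<zero>" "x \<in> carrier R" for x
  proof -
    have "x \<otimes> (w \<otimes> i) = (w \<otimes> x) \<otimes> i" using w wi that by (simp add: m_ac)
    then show ?thesis using that wi by simp
  qed
  \<comment> \<open>Either choice lies in \<open>R \<Join> I\<close>, since its coordinates differ
    by \<open>w \<otimes> i\<close> up to sign. The zero entry absorbs the coordinate of
    \<open>p\<close> that \<open>w\<close> might not kill.\<close>
  define c where "c = (if f = fst then (w \<otimes> i, \<zero>) else (\<zero>, w \<otimes> i))"
  have "c \<in> carrier (R \<Join> I)" "c \<noteq> \<zero>\<^bsub>R \<Join> I\<^esub>"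
    using wi i(2) by (simp_all add: c_def simps minus_eq)
  moreover have "p \<otimes>\<^bsub>R \<Join> I\<^esub> c = \<zero>\<^bsub>R \<Join> I\<^esub>" if "p \<in> carrier (R \<Join> I)" "w \<otimes> f p = \<zero>" for p
  proof (cases "f = fst")
    case True
    then show ?thesis using that kills[of "fst p"] by (simp add: c_def simps)
  next
    case False
    then show ?thesis using f that kills[of "snd p"] by (simp add: c_def simps)
  qed
  ultimately show thesis by (rule that)
qed

text \<open>A nonzero annihilator of \<open>x\<close> has a nonzero coordinate, which makes that
  coordinate of \<open>x\<close> a zero-divisor. The other coordinate differs from it by an element
  of \<open>I\<close>, and closure of \<open>zero_divisors R\<close> under addition and negation
  carries the property across.\<close>

lemma amalgamated_duplication_zero_divisors:
  assumes "cring R" and "I \<subseteq> zero_divisors R" and "ideal (zero_divisors R) R"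
    and x: "x \<in> zero_divisors (R \<Join> I)"
  shows "fst x \<in> zero_divisors R" and "snd x \<in> zero_divisors R"
proof -
  interpret cring R by fact
  interpret Z: ideal "zero_divisors R" R by fact
  note simps = amalgamated_duplication_simps amalgamated_duplication_carrier_iff
  from x obtain y where y: "y \<in> carrier (R \<Join> I)" "y \<noteq> \<zero>\<^bsub>R \<Join> I\<^esub>" "x \<otimes>\<^bsub>R \<Join> I\<^esub> y = \<zero>\<^bsub>R \<Join> I\<^esub>"
    and xc: "x \<in> carrier (R \<Join> I)"
    by (auto simp: zero_divisors_def)
  have car: "fst x \<in> carrier R" "snd x \<in> carrier R" using xc by (auto simp: simps)
  have snd: "fst x \<oplus> (snd x \<ominus> fst x) = snd x"
    using car by (simp add: add_diff_cancel_carrier)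
  have diff: "snd x \<ominus> fst x \<in> zero_divisors R"
    using xc assms(2) by (auto simp: simps)
  have "fst x \<in> zero_divisors R \<or> snd x \<in> zero_divisors R"
  proof -
    have "fst y \<in> carrier R" "snd y \<in> carrier R" "fst y \<noteq> \<zero> \<or> snd y \<noteq> \<zero>"
      "fst x \<otimes> fst y = \<zero>" "snd x \<otimes> snd y = \<zero>"
      using y by (simp_all add: simps prod_eq_iff)
    then show ?thesis
      using car unfolding zero_divisors_def by blast
  qed
  moreover have "snd x \<in> zero_divisors R" if "fst x \<in> zero_divisors R"
    using Z.a_closed[OF that diff] snd by simp
  moreover have "fst x \<in> zero_divisors R" if "snd x \<in> zero_divisors R"
  proof -
    have "snd x \<oplus> \<ominus> (snd x \<ominus> fst x) = fst x \<oplus> ((snd x \<ominus> fst x) \<oplus> \<ominus> (snd x \<ominus> fst x))"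
      using car by (subst (1) snd[symmetric]) (rule a_assoc, auto)
    also have "\<dots> = fst x" using car by (subst r_neg) auto
    finally show ?thesis using Z.a_closed[OF that Z.a_inv_closed[OF diff]] by simp
  qed
  ultimately show "fst x \<in> zero_divisors R" "snd x \<in> zero_divisors R" by blast+
qed

end

section \<open>Upper and lower bound for the diameter over the duplication\<close>

theorem proposition3p8:
  fixes R :: "('a, 'm) ring_scheme" and I :: "'a set"
  assumes "cring R" and "\<one>\<^bsub>R\<^esub> \<noteq> \<zero>\<^bsub>R\<^esub>"
    and "ideal I R"
    and "I \<subseteq> zero_divisors R"
    and "ideal (zero_divisors R) R"
    and "graph_diam (ext_zero_divisor_graph R) = 2"
    and "condition_A (ext_zero_divisor_graph R)"
  shows "graph_diam (ext_zero_divisor_graph (R \<Join> I)) = 2"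
proof -
  interpret cring R by fact
  interpret I: ideal I R by fact
  interpret D: cring "R \<Join> I" by (rule amalgamated_duplication_cring) fact
  interpret G: pair_loopfree_digraph EZG by (rule ext_zero_divisor_graph_simple)
  interpret H: pair_loopfree_digraph D.EZG by (rule D.ext_zero_divisor_graph_simple)
  note simps = amalgamated_duplication_simps I.amalgamated_duplication_carrier_iff
  have "graph_dist D.EZG a b \<le> 2" if a: "a \<in> pverts D.EZG" and b: "b \<in> pverts D.EZG" for a b
  proof -
    have acar: "a \<in> carrier (R \<Join> I)" and bcar: "b \<in> carrier (R \<Join> I)"
      using a b by (auto simp: D.pverts_EZG_iff D.zero_divisors_carrier)
    \<comment> \<open>In a coordinate where both are nonzero, \<open>a\<close> and \<open>b\<close>
      project to vertices of the graph of \<open>R\<close>, possibly to the same one.\<close>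
    have f: ?thesis if f: "f = fst \<or> f = snd" and nz: "f a \<noteq> \<zero>\<^bsub>R\<^esub>" "f b \<noteq> \<zero>\<^bsub>R\<^esub>" for f
    proof -
      have "f a \<in> pverts EZG" "f b \<in> pverts EZG"
        using a b f nz
        by (auto simp: D.pverts_EZG_iff pverts_EZG_iff
            intro: I.amalgamated_duplication_zero_divisors[OF assms(1,4,5)])
      then obtain w and n m :: nat where w: "w \<in> carrier R" "w \<noteq> \<zero>\<^bsub>R\<^esub>"
        and nm: "n \<ge> 1" "m \<ge> 1" "f a [^]\<^bsub>R\<^esub> n \<noteq> \<zero>\<^bsub>R\<^esub>" "f b [^]\<^bsub>R\<^esub> m \<noteq> \<zero>\<^bsub>R\<^esub>"
          "w \<otimes>\<^bsub>R\<^esub> f a [^]\<^bsub>R\<^esub> n = \<zero>\<^bsub>R\<^esub>" "w \<otimes>\<^bsub>R\<^esub> f b [^]\<^bsub>R\<^esub> m = \<zero>\<^bsub>R\<^esub>"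
        using common_annihilator_of_powers[OF _ _ assms(6,7)] by metis
      obtain c where c: "c \<in> carrier (R \<Join> I)" "c \<noteq> \<zero>\<^bsub>R \<Join> I\<^esub>"
        and kills: "\<And>p. p \<in> carrier (R \<Join> I) \<Longrightarrow> w \<otimes>\<^bsub>R\<^esub> f p = \<zero>\<^bsub>R\<^esub> \<Longrightarrow> p \<otimes>\<^bsub>R \<Join> I\<^esub> c = \<zero>\<^bsub>R \<Join> I\<^esub>"
        using I.amalgamated_duplication_annihilator[OF assms(1) f w] by metis
      have pow: "f (x [^]\<^bsub>R \<Join> I\<^esub> k) = f x [^]\<^bsub>R\<^esub> k" for x and k :: nat
        using f by (auto simp: simps)
      have zero: "f \<zero>\<^bsub>R \<Join> I\<^esub> = \<zero>\<^bsub>R\<^esub>" using f by (auto simp: simps)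
      \<comment> \<open>A power is nonzero as soon as its image under \<open>f\<close> is.\<close>
      have nz': "a [^]\<^bsub>R \<Join> I\<^esub> n \<noteq> \<zero>\<^bsub>R \<Join> I\<^esub>" "b [^]\<^bsub>R \<Join> I\<^esub> m \<noteq> \<zero>\<^bsub>R \<Join> I\<^esub>"
        using nm pow zero by metis+
      show ?thesis
        by (rule D.graph_dist_le_2_if_common_annihilator[OF a nm(1) nz'(1) _ b nm(2) nz'(2) _ c])
           (use nm acar bcar in \<open>auto intro!: kills simp: pow\<close>)
    qed
    show ?thesis
    proof (cases "(fst a \<noteq> \<zero>\<^bsub>R\<^esub> \<and> fst b \<noteq> \<zero>\<^bsub>R\<^esub>) \<or> (snd a \<noteq> \<zero>\<^bsub>R\<^esub> \<and> snd b \<noteq> \<zero>\<^bsub>R\<^esub>)")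
      case True
      then show ?thesis using f by blast
    next
      case False
      \<comment> \<open>In each coordinate one of the two factors is zero, so distinct
        \<open>a\<close> and \<open>b\<close> are adjacent already with exponents 1.\<close>
      then have "a \<otimes>\<^bsub>R \<Join> I\<^esub> b = \<zero>\<^bsub>R \<Join> I\<^esub>"
        using acar bcar by (auto simp: simps)
      then have "a = b \<or> (a, b) \<in> parcs D.EZG"
        using D.parcs_EZG_if_kills_power[OF a bcar, of 1] a b acar
        by (auto simp: D.pverts_EZG_iff)
      then show ?thesis unfolding H.graph_dist_le_2_iff[OF a] by blast
    qed
  qed
  then have upper: "graph_diam D.EZG \<le> 2"
    unfolding graph_diam_def by (intro SUP_least)
  \<comment> \<open>The strict bound on the supremum is witnessed by a pair of vertices, necessarily
    distinct and non-adjacent.\<close>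
  have "1 < graph_diam EZG" using assms(6) by simp
  then obtain x y where xy: "x \<in> pverts EZG" "y \<in> pverts EZG" "1 < graph_dist EZG x y"
    unfolding graph_diam_def less_SUP_iff by blast
  then have nonadj: "x \<noteq> y" "(x, y) \<notin> parcs EZG"
    using G.graph_dist_le_1_iff[OF xy(1), of y] by (auto simp: not_le[symmetric])
  have diag: "(z, z) \<in> pverts D.EZG" if z: "z \<in> pverts EZG" for z
  proof -
    obtain u where u: "u \<in> carrier R" "u \<noteq> \<zero>\<^bsub>R\<^esub>" "z \<otimes>\<^bsub>R\<^esub> u = \<zero>\<^bsub>R\<^esub>" and "z \<in> carrier R" "z \<noteq> \<zero>\<^bsub>R\<^esub>"
      using z by (auto simp: pverts_EZG_iff zero_divisors_def)
    moreover have "(r, r) \<in> carrier (R \<Join> I)" if "r \<in> carrier R" for r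
      using that by (simp add: simps minus_eq r_neg)
    ultimately show ?thesis
      unfolding D.pverts_EZG_iff zero_divisors_def
      by (auto simp: simps(1,2) intro!: bexI[of _ "(u, u)"])
  qed
  \<comment> \<open>Powers and products of diagonal elements are computed in \<open>R\<close>, so an
    arc here would give one between \<open>x\<close> and \<open>y\<close>.\<close>
  have "((x, x), (y, y)) \<notin> parcs D.EZG"
    using nonadj xy by (auto simp: D.parcs_EZG_iff parcs_EZG_iff simps(1-3))
  then have "\<not> graph_dist D.EZG (x, x) (y, y) \<le> 1"
    unfolding H.graph_dist_le_1_iff[OF diag[OF xy(1)]] using nonadj by simp
  moreover have "graph_dist D.EZG (x, x) (y, y) \<le> graph_diam D.EZG"
    unfolding graph_diam_def using diag xy by (meson SUP_upper2 SUP_upper order_refl)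
  ultimately have "1 < graph_diam D.EZG" by simp
  then have "2 \<le> graph_diam D.EZG"
    by (cases "graph_diam D.EZG") (auto simp: one_enat_def numeral_eq_enat)
  with upper show ?thesis by (rule antisym)
qed

end
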